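(* There is an absolute constant $C>0$ such that for all integers $n\ge 1$, $k\ge 2$, every $\varepsilon\in(0,1)$, and all $\alpha\in\mathbb{R}$, $\beta\in\mathbb{R}\cup\{+\infty\}$ with $\alpha<\beta$, there exists a non-adaptive, one-sided $(\alpha,\beta)$-Lipschitz tester, with parameter $\varepsilon$, for functions $f:[k]^n\to\mathbb{R}$ that makes at most $C\varepsilon^{-1}n\log_2(2k)$ queries, i.e. $O(\varepsilon^{-1}n\log k)$ queries. In particular the bound does not depend on $\alpha$ and $\beta$.
   Context: $[k]=\{1,\dots,k\}$. A function $f:[k]^n\to\mathbb{R}$ is $(\alpha,\beta)$-Lipschitz if for every $x\in[k]^n$ and every $y\in[k]^n$ obtained from $x$ by increasing exactly one coordinate by exactly $1$, one has $\alpha\le f(y)-f(x)\le\beta$. (With $\alpha=0,\beta=+\infty$ this is monotonicity; with $\alpha=-c,\beta=c$ it is the $c$-Lipschitz property.) The distance of $f$ to the property is $\varepsilon_f=\min_g|\{x:f(x)\ne g(x)\}|/k^n$, the minimum being over all $(\alpha,\beta)$-Lipschitz $g:[k]^n\to\mathbb{R}$. A one-sided $(\alpha,\beta)$-Lipschitz tester with parameter $\varepsilon$ is a randomized algorithm with query access to $f$ that accepts with probability $1$ if $f$ is $(\alpha,\beta)$-Lipschitz and rejects with probability greater than $2/3$ if $\varepsilon_f>\varepsilon$. It is non-adaptive if all query points are chosen (using the algorithm's randomness) in advance, independently of the answers received. *)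

theory Defs
  imports "HOL-Probability.Probability"
begin

type_synonym point = "nat \<Rightarrow> nat"

definition grid :: "nat \<Rightarrow> nat \<Rightarrow> point set" where
  "grid n k = ({1..n} \<rightarrow>\<^sub>E {1..k})"

text \<open>Functions \<open>[k]\<^sup>n \<rightarrow> \<real>\<close> are represented by total functions on \<open>point\<close>; values
  outside \<open>grid n k\<close> are irrelevant, and testers may query points of \<open>grid n k\<close> only.\<close>

definition ab_lipschitz :: "nat \<Rightarrow> nat \<Rightarrow> real \<Rightarrow> ereal \<Rightarrow> (point \<Rightarrow> real) \<Rightarrow> bool" where
  "ab_lipschitz n k \<alpha> \<beta> f \<longleftrightarrow>
     (\<forall>x\<in>grid n k. \<forall>y\<in>grid n k. (\<exists>i\<in>{1..n}. y = x(i := x i + 1)) \<longrightarrow>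
        \<alpha> \<le> f y - f x \<and> ereal (f y - f x) \<le> \<beta>)"

definition ab_dist :: "nat \<Rightarrow> nat \<Rightarrow> real \<Rightarrow> ereal \<Rightarrow> (point \<Rightarrow> real) \<Rightarrow> real" where
  "ab_dist n k \<alpha> \<beta> f =
     Min ((\<lambda>g. real (card {x \<in> grid n k. f x \<noteq> g x}) / real k ^ n) ` {g. ab_lipschitz n k \<alpha> \<beta> g})"

text \<open>The lemmas below show that this \<open>Min\<close> is taken over a finite set, nonempty if \<open>\<alpha> \<le> \<beta>\<close>.\<close>

lemma finite_grid: "finite (grid n k)"
  by (simp add: grid_def finite_PiE)

lemma ab_dist_finite:
  "finite ((\<lambda>g. real (card {x \<in> grid n k. f x \<noteq> g x}) / real k ^ n) ` {g. ab_lipschitz n k \<alpha> \<beta> g})"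
proof (rule finite_subset)
  show "(\<lambda>g. real (card {x \<in> grid n k. f x \<noteq> g x}) / real k ^ n) ` {g. ab_lipschitz n k \<alpha> \<beta> g}
      \<subseteq> (\<lambda>m. real m / real k ^ n) ` {..card (grid n k)}"
    by (auto intro!: imageI card_mono finite_grid)
qed simp

lemma ab_lipschitz_exists:
  assumes "ereal \<alpha> \<le> \<beta>"
  shows "\<exists>g. ab_lipschitz n k \<alpha> \<beta> g"
proof -
  have "(\<Sum>j\<in>{1..n}. real ((x(i := x i + 1)) j)) = (\<Sum>j\<in>{1..n}. real (x j)) + 1"
    if "i \<in> {1..n}" for i and x :: point
  proof -
    have "(\<Sum>j\<in>{1..n}. real ((x(i := x i + 1)) j))
        = (\<Sum>j\<in>{1..n}. real (x j) + (if j = i then 1 else 0))"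
      by (rule sum.cong) auto
    then show ?thesis using that by (simp add: sum.distrib)
  qed
  then have "ab_lipschitz n k \<alpha> \<beta> (\<lambda>x. \<alpha> * (\<Sum>j\<in>{1..n}. real (x j)))"
    using assms unfolding ab_lipschitz_def
    by (auto simp: algebra_simps simp del: fun_upd_apply)
  then show ?thesis by blast
qed

text \<open>A deterministic algorithm with query access is a decision tree: it either accepts
  (\<open>Decide True\<close>) or rejects, or it queries a point and continues depending on the answer.
  A randomized algorithm is a probability distribution over deterministic ones.\<close>

datatype 'p query_alg = Decide bool | Query 'p "real \<Rightarrow> 'p query_alg"

primrec accepts :: "'p query_alg \<Rightarrow> ('p \<Rightarrow> real) \<Rightarrow> bool" where
  "accepts (Decide b) f = b"
| "accepts (Query x c) f = accepts (c (f x)) f"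

primrec queries :: "'p query_alg \<Rightarrow> ('p \<Rightarrow> real) \<Rightarrow> 'p list" where
  "queries (Decide b) f = []"
| "queries (Query x c) f = x # queries (c (f x)) f"

definition nonadaptive :: "'p query_alg pmf \<Rightarrow> bool" where
  "nonadaptive T \<longleftrightarrow> (\<forall>A\<in>set_pmf T. \<exists>qs. \<forall>f. queries A f = qs)"

definition one_sided_tester ::
  "nat \<Rightarrow> nat \<Rightarrow> real \<Rightarrow> ereal \<Rightarrow> real \<Rightarrow> point query_alg pmf \<Rightarrow> bool" where
  "one_sided_tester n k \<alpha> \<beta> \<epsilon> T \<longleftrightarrow>
     (\<forall>A\<in>set_pmf T. \<forall>f. set (queries A f) \<subseteq> grid n k) \<and>
     (\<forall>f. ab_lipschitz n k \<alpha> \<beta> f \<longrightarrow> measure_pmf.prob T {A. accepts A f} = 1) \<and>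
     (\<forall>f. ab_dist n k \<alpha> \<beta> f > \<epsilon> \<longrightarrow> measure_pmf.prob T {A. \<not> accepts A f} > 2 / 3)"

text \<open>Worst-case number of queries, over all inputs and all outcomes of the randomness;
  repeated queries to the same point are counted each time.\<close>

definition makes_at_most :: "'p query_alg pmf \<Rightarrow> real \<Rightarrow> bool" where
  "makes_at_most T q \<longleftrightarrow> (\<forall>A\<in>set_pmf T. \<forall>f. real (length (queries A f)) \<le> q)"

end

theory Submission
  imports Defs
begin

text \<open>
  An affine change of \<open>f\<close> turns the property into being \<open>1\<close>-Lipschitz for the \<open>\<ell>\<^sub>1\<close> metric; for
  \<open>\<beta> = \<infinity>\<close> one first replaces \<open>\<beta>\<close> by a bound so large that it excludes nothing for the given \<open>f\<close>.
  The number of values to be changed is compared along the coordinates by linear programming.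
  Let \<open>E\<^sub>t\<close> be the infimum of \<open>\<Sum>x. b x - a x\<close> over \<open>a \<le> f \<le> b\<close> with \<open>a x - b y \<le> d x y + t\<close>
  (for \<open>t = 0\<close> this is the \<open>L\<^sub>1\<close> distance to the Lipschitz functions), and \<open>E\<^sub>t\<^sup>J\<close> the same with the
  constraint imposed only on pairs that agree on the coordinates in \<open>J\<close>.

  For small \<open>t\<close>, moving \<open>a\<close> and \<open>b\<close> by \<open>t / 2\<close> towards \<open>f\<close> shows that the drop \<open>E\<^sub>0 - E\<^sub>t\<close> is at least
  \<open>t / 2\<close> times the number of values to be changed. Changing one value of \<open>f\<close> alters the drop by
  at most \<open>t\<close>. If \<open>f\<close> is Lipschitz along coordinate \<open>j\<close>, then adding \<open>j\<close> to \<open>J\<close> does not change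
  \<open>E\<^sub>t\<^sup>J\<close>, because optimal pairs on the layers depend monotonically on \<open>f\<close>. As the drop vanishes when
  \<open>J\<close> contains all coordinates, it is at most \<open>2 t\<close> times the total number of values to be changed
  to make \<open>f\<close> Lipschitz on the lines of each single direction.

  On a line, any two points have a common dyadic midpoint between them, so comparing a random
  point with its \<open>O(log k)\<close> dyadic midpoints detects every point that has to be changed.
\<close>

section \<open>Feasible pairs and the infimum of their widths\<close>

text \<open>A Lipschitz g is encoded by the pair a = min f g, b = max f g, whose width is the L1
  distance of f and g. Pairs leave room for the slack t and can be combined by pointwise min and
  max.\<close>

definition sandwich ::
  "('a \<Rightarrow> 'a \<Rightarrow> bool) \<Rightarrow> ('a \<Rightarrow> 'a \<Rightarrow> real) \<Rightarrow> 'a set \<Rightarrow> real \<Rightarrow> ('a \<Rightarrow> real) \<Rightarrow> ('a \<Rightarrow> real) \<Rightarrow> ('a \<Rightarrow> real) \<Rightarrow> bool"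
  where "sandwich R d X t f a b \<longleftrightarrow>
    (\<forall>x\<in>X. a x \<le> f x \<and> f x \<le> b x) \<and> (\<forall>x\<in>X. \<forall>y\<in>X. R x y \<longrightarrow> a x - b y \<le> d x y + t)"

definition width :: "'a set \<Rightarrow> ('a \<Rightarrow> real) \<Rightarrow> ('a \<Rightarrow> real) \<Rightarrow> real"
  where "width X a b = (\<Sum>x\<in>X. b x - a x)"

definition gap ::
  "('a \<Rightarrow> 'a \<Rightarrow> bool) \<Rightarrow> ('a \<Rightarrow> 'a \<Rightarrow> real) \<Rightarrow> 'a set \<Rightarrow> real \<Rightarrow> ('a \<Rightarrow> real) \<Rightarrow> real"
  where "gap R d X t f = Inf {w. \<exists>a b. sandwich R d X t f a b \<and> w = width X a b}"

lemma width_nonneg: "sandwich R d X t f a b \<Longrightarrow> 0 \<le> width X a b"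
  unfolding width_def sandwich_def by (force intro!: sum_nonneg)

lemma gap_le_width: "sandwich R d X t f a b \<Longrightarrow> gap R d X t f \<le> width X a b"
  unfolding gap_def
  by (rule cInf_lower) (auto intro!: bdd_belowI[of _ 0] dest: width_nonneg)

text \<open>The constants -M and M, with M a bound on the absolute value of f, are feasible; hence
  the infimum in \<open>gap\<close> runs over a nonempty set.\<close>

lemma sandwich_exists:
  assumes "finite X" "\<forall>x y. 0 \<le> d x y" "0 \<le> t"
  shows "\<exists>a b. sandwich R d X t f a b"
proof -
  define M where "M = (\<Sum>x\<in>X. \<bar>f x\<bar>)"
  have "\<bar>f x\<bar> \<le> M" if "x \<in> X" for x
    unfolding M_def using that assms(1) by (intro member_le_sum) auto
  moreover have "0 \<le> M" unfolding M_def by (simp add: sum_nonneg)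
  ultimately have "sandwich R d X t f (\<lambda>_. - M) (\<lambda>_. M)"
    unfolding sandwich_def using assms(2,3)
    by (smt (verit, best))
  then show ?thesis by blast
qed

lemma gap_greatest:
  assumes "finite X" "\<forall>x y. 0 \<le> d x y" "0 \<le> t"
    and "\<And>a b. sandwich R d X t f a b \<Longrightarrow> w \<le> width X a b"
  shows "w \<le> gap R d X t f"
  unfolding gap_def
  by (rule cInf_greatest) (use assms sandwich_exists[OF assms(1,2,3)] in auto)

text \<open>Pairs that are optimal up to \<delta> stand in for optimal ones, so attainment of the
  infimum is not at issue.\<close>

lemma gap_approx:
  assumes "finite X" "\<forall>x y. 0 \<le> d x y" "0 \<le> t" "0 < \<delta>"
  obtains a b where "sandwich R d X t f a b" "width X a b < gap R d X t f + \<delta>"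
proof -
  have "\<not> gap R d X t f + \<delta> \<le> gap R d X t f" using assms(4) by simp
  then show ?thesis
    using gap_greatest[OF assms(1,2,3), of R f "gap R d X t f + \<delta>"] that by force
qed

lemma sandwich_relax:
  assumes "sandwich R d X t f a b" "\<And>x y. R' x y \<Longrightarrow> R x y"
  shows "sandwich R' d X t f a b"
  using assms unfolding sandwich_def by blast

lemma gap_mono_rel:
  assumes "finite X" "\<forall>x y. 0 \<le> d x y" "0 \<le> t" "\<And>x y. R' x y \<Longrightarrow> R x y"
  shows "gap R' d X t f \<le> gap R d X t f"
  by (rule gap_greatest[OF assms(1-3)])
     (auto intro: gap_le_width sandwich_relax assms(4))

lemma sandwich_add_const:
  "sandwich R d X t f a b \<Longrightarrow> sandwich R d X t (\<lambda>x. f x + s) (\<lambda>x. a x + s) (\<lambda>x. b x + s)"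
  unfolding sandwich_def by auto

lemma gap_add_const_ge:
  assumes "finite X" "\<forall>x y. 0 \<le> d x y" "0 \<le> t"
  shows "gap R d X t f \<le> gap R d X t (\<lambda>x. f x + s)"
proof (rule gap_greatest[OF assms])
  fix a b assume "sandwich R d X t (\<lambda>x. f x + s) a b"
  from sandwich_add_const[OF this, of "- s"]
  have "gap R d X t f \<le> width X (\<lambda>x. a x + - s) (\<lambda>x. b x + - s)"
    by (intro gap_le_width) simp
  then show "gap R d X t f \<le> width X a b" by (simp add: width_def)
qed

text \<open>Negation exchanges the roles of a and b; symmetry of R and d turns the constraint for
  (x, y) into that for (y, x).\<close>

lemma sandwich_uminus:
  assumes "sandwich R d X t f a b" "symp R" "\<forall>x y. d x y = d y x"
  shows "sandwich R d X t (\<lambda>x. - f x) (\<lambda>x. - b x) (\<lambda>x. - a x)"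
  using assms unfolding sandwich_def symp_def by (smt (verit))

lemma gap_uminus:
  assumes "finite X" "\<forall>x y. 0 \<le> d x y" "0 \<le> t"
    "symp R" "\<forall>x y. d x y = d y x"
  shows "gap R d X t (\<lambda>x. - f x) = gap R d X t f"
proof -
  have *: "gap R d X t (\<lambda>x. - g x) \<le> gap R d X t g" for g
  proof (rule gap_greatest[OF assms(1-3)])
    fix a b assume "sandwich R d X t g a b"
    from gap_le_width[OF sandwich_uminus[OF this assms(4,5)]]
    show "gap R d X t (\<lambda>x. - g x) \<le> width X a b" by (simp add: width_def algebra_simps)
  qed
  from *[of f] *[of "\<lambda>x. - f x"] show ?thesis by simp
qed

section \<open>Exchange arguments with pointwise minima and maxima\<close>

text \<open>The minimum of b and b' at y comes from one of the two pairs, and the minimum of a and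
  a' at x is at most the lower bound of that same pair. The order f \<le> f' keeps f below
  b'.\<close>

lemma sandwich_min:
  assumes "sandwich R d X t f a b" "sandwich R d X t f' a' b'" "\<And>x. x \<in> X \<Longrightarrow> f x \<le> f' x"
  shows "sandwich R d X t f (\<lambda>x. min (a x) (a' x)) (\<lambda>x. min (b x) (b' x))"
  using assms unfolding sandwich_def by (smt (verit))

lemma sandwich_max:
  assumes "sandwich R d X t f a b" "sandwich R d X t f' a' b'" "\<And>x. x \<in> X \<Longrightarrow> f x \<le> f' x"
  shows "sandwich R d X t f' (\<lambda>x. max (a x) (a' x)) (\<lambda>x. max (b x) (b' x))"
  using assms unfolding sandwich_def by (smt (verit))

lemma width_min_max:
  "width X (\<lambda>x. min (a x) (a' x)) (\<lambda>x. min (b x) (b' x))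
     + width X (\<lambda>x. max (a x) (a' x)) (\<lambda>x. max (b x) (b' x)) = width X a b + width X a' b'"
  unfolding width_def sum.distrib[symmetric]
  by (rule sum.cong) (auto simp: min_def max_def)

text \<open>The pair of maxima competes for f', so its width is at least that of (a', b') up to
  \<delta>. Since the total width is preserved, the pair of minima exceeds (a, b) by at most
  \<delta>.\<close>

lemma width_min_le:
  assumes "sandwich R d X t f a b" "sandwich R d X t f' a' b'" "\<And>x. x \<in> X \<Longrightarrow> f x \<le> f' x"
    and "width X a' b' \<le> gap R d X t f' + \<delta>"
  shows "width X (\<lambda>x. min (a x) (a' x)) (\<lambda>x. min (b x) (b' x)) \<le> width X a b + \<delta>"
  using gap_le_width[OF sandwich_max[OF assms(1-3)]] width_min_max[of X a a' b b'] assms(4)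
  by linarith

text \<open>The pairs are merged into that of \<open>c\<^sub>0\<close> one at a time; the initial
  pair and each merge cost \<delta>.\<close>

lemma sandwich_Min:
  assumes "finite C" "c\<^sub>0 \<in> C"
    and sw: "\<And>c. c \<in> C \<Longrightarrow> sandwich R d X t (F c) (A c) (B c)"
    and le: "\<And>c x. c \<in> C \<Longrightarrow> x \<in> X \<Longrightarrow> F c\<^sub>0 x \<le> F c x"
    and wd: "\<And>c. c \<in> C \<Longrightarrow> width X (A c) (B c) \<le> gap R d X t (F c) + \<delta>"
  shows "sandwich R d X t (F c\<^sub>0) (\<lambda>x. MIN c\<in>C. A c x) (\<lambda>x. MIN c\<in>C. B c x) \<and>
    width X (\<lambda>x. MIN c\<in>C. A c x) (\<lambda>x. MIN c\<in>C. B c x) \<le> gap R d X t (F c\<^sub>0) + real (card C) * \<delta>"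
proof -
  have "sandwich R d X t (F c\<^sub>0) (\<lambda>x. MIN c\<in>insert c\<^sub>0 D. A c x) (\<lambda>x. MIN c\<in>insert c\<^sub>0 D. B c x) \<and>
    width X (\<lambda>x. MIN c\<in>insert c\<^sub>0 D. A c x) (\<lambda>x. MIN c\<in>insert c\<^sub>0 D. B c x)
      \<le> gap R d X t (F c\<^sub>0) + real (card D + 1) * \<delta>"
    if "finite D" "D \<subseteq> C - {c\<^sub>0}" for D
    using that
  proof (induction D)
    case empty
    then show ?case using sw wd assms(2) by simp
  next
    case (insert c D)
    let ?a = "\<lambda>x. MIN c\<in>insert c\<^sub>0 D. A c x" and ?b = "\<lambda>x. MIN c\<in>insert c\<^sub>0 D. B c x"
    have IH: "sandwich R d X t (F c\<^sub>0) ?a ?b"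
      "width X ?a ?b \<le> gap R d X t (F c\<^sub>0) + real (card D + 1) * \<delta>"
      using insert by auto
    have c: "c \<in> C" using insert by auto
    have eq: "(MIN c\<in>insert c\<^sub>0 (insert c D). G c x) = min (MIN c\<in>insert c\<^sub>0 D. G c x) (G c x)"
      for G :: "_ \<Rightarrow> _ \<Rightarrow> real" and x
      using insert.hyps(1) by (simp add: insert_commute[of c\<^sub>0 c] min.commute)
    show ?case
      unfolding eq
      using sandwich_min[OF IH(1) sw[OF c] le[OF c]]
        width_min_le[OF IH(1) sw[OF c] le[OF c] wd[OF c]] IH(2) insert.hyps
      by (auto simp: algebra_simps)
  qed
  moreover have "insert c\<^sub>0 (C - {c\<^sub>0}) = C" "card (C - {c\<^sub>0}) + 1 = card C"
    using assms(1,2) card.remove[of C c\<^sub>0] by auto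
  ultimately show ?thesis using assms(1) by (metis finite_Diff order_refl)
qed

text \<open>Shifting \<open>a\<close> by \<open>t\<close> turns both constraints into the same one, which is stable under
  pointwise minimum and maximum; exchanging these costs \<open>t\<close> only where \<open>f\<close> and \<open>f'\<close> differ.\<close>

lemma gap_swap:
  assumes "finite X" "\<forall>x y. 0 \<le> d x y" "0 \<le> t" "\<And>x. x \<in> X \<Longrightarrow> f x \<le> f' x"
  shows "gap R d X t f + gap R d X 0 f' \<le> gap R d X 0 f + gap R d X t f'
    + t * real (card {x \<in> X. f x \<noteq> f' x})"
proof (rule field_le_epsilon)
  fix e :: real assume e: "0 < e"
  define V where "V = {x \<in> X. f x \<noteq> f' x}"
  obtain a b where ab: "sandwich R d X 0 f a b" "width X a b < gap R d X 0 f + e / 2"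
    using gap_approx[OF assms(1,2) order_refl, of "e / 2" R f] e by auto
  obtain a' b' where ab': "sandwich R d X t f' a' b'" "width X a' b' < gap R d X t f' + e / 2"
    using gap_approx[OF assms(1,2,3), of "e / 2" R f'] e by auto
  \<comment> \<open>Off V the shift by t is undone: there \<open>?u x\<close> is the minimum of a x
    + t and a' x, and a' x \<le> f' x = f x keeps it below f. On V only a x \<le> f x is available,
    so the shift stays.\<close>
  let ?u = "\<lambda>x. min (a x) (a' x - t) + (if x \<in> V then 0 else t)"
  have le: "x \<in> X \<Longrightarrow> x \<notin> V \<Longrightarrow> f x = f' x" for x by (auto simp: V_def)
  have 1: "sandwich R d X t f ?u (\<lambda>x. min (b x) (b' x))"
    unfolding sandwich_def
  proof (intro conjI ballI impI)
    fix x assume x: "x \<in> X"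
    then have "a x \<le> f x" "a' x \<le> f' x" "f x \<le> b x" "f' x \<le> b' x" "f x \<le> f' x"
      using ab(1) ab'(1) assms(4) by (auto simp: sandwich_def)
    then show "?u x \<le> f x" "f x \<le> min (b x) (b' x)" using le[OF x] by auto
  next
    fix x y assume xy: "x \<in> X" "y \<in> X" "R x y"
    then have "a x - b y \<le> d x y" "a' x - b' y \<le> d x y + t"
      using ab(1) ab'(1) by (auto simp: sandwich_def)
    then show "?u x - min (b y) (b' y) \<le> d x y + t" using assms(3) by auto
  qed
  have 2: "sandwich R d X 0 f' (\<lambda>x. max (a x) (a' x - t)) (\<lambda>x. max (b x) (b' x))"
    unfolding sandwich_def
  proof (intro conjI ballI impI)
    fix x assume x: "x \<in> X"
    then have "a x \<le> f x" "a' x \<le> f' x" "f x \<le> b x" "f' x \<le> b' x" "f x \<le> f' x"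
      using ab(1) ab'(1) assms(4) by (auto simp: sandwich_def)
    then show "max (a x) (a' x - t) \<le> f' x" "f' x \<le> max (b x) (b' x)"
      using assms(3) by auto
  next
    fix x y assume xy: "x \<in> X" "y \<in> X" "R x y"
    then have "a x - b y \<le> d x y" "a' x - b' y \<le> d x y + t"
      using ab(1) ab'(1) by (auto simp: sandwich_def)
    then show "max (a x) (a' x - t) - max (b y) (b' y) \<le> d x y + 0" by auto
  qed
  have "width X ?u (\<lambda>x. min (b x) (b' x)) + width X (\<lambda>x. max (a x) (a' x - t)) (\<lambda>x. max (b x) (b' x))
    = (\<Sum>x\<in>X. (b x - a x) + (b' x - a' x) + (if x \<in> V then t else 0))"
    unfolding width_def sum.distrib[symmetric] by (rule sum.cong) auto
  also have "\<dots> = width X a b + width X a' b' + t * real (card V)"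
    using assms(1) by (simp add: sum.distrib width_def sum.If_cases V_def Int_def)
  finally show "gap R d X t f + gap R d X 0 f' \<le> gap R d X 0 f + gap R d X t f'
      + t * real (card {x \<in> X. f x \<noteq> f' x}) + e"
    using gap_le_width[OF 1] gap_le_width[OF 2] ab(2) ab'(2) unfolding V_def by linarith
qed

text \<open>Both functions are compared with their pointwise maximum, g by \<open>gap_swap\<close>
  directly and f by \<open>gap_swap\<close> after negation. A point where f and g differ is charged
  in only one of the two steps.\<close>

lemma gap_drop_perturb:
  assumes "finite X" "\<forall>x y. 0 \<le> d x y" "0 \<le> t"
    "symp R" "\<forall>x y. d x y = d y x"
  shows "gap R d X 0 f - gap R d X t f \<le> gap R d X 0 g - gap R d X t g
    + t * real (card {x \<in> X. f x \<noteq> g x})"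
proof -
  let ?m = "\<lambda>x. max (f x) (g x)"
  have 1: "gap R d X t g + gap R d X 0 ?m \<le> gap R d X 0 g + gap R d X t ?m
    + t * real (card {x \<in> X. g x \<noteq> ?m x})"
    by (rule gap_swap[OF assms(1-3)]) auto
  have 2: "gap R d X t ?m + gap R d X 0 f \<le> gap R d X 0 ?m + gap R d X t f
    + t * real (card {x \<in> X. f x \<noteq> ?m x})"
    using gap_swap[OF assms(1-3), of "\<lambda>x. - ?m x" "\<lambda>x. - f x" R]
      gap_uminus[OF assms] gap_uminus[OF assms(1,2) order_refl assms(4,5)]
    by (simp add: eq_commute)
  have "card {x \<in> X. f x \<noteq> g x} = card ({x \<in> X. g x \<noteq> ?m x} \<union> {x \<in> X. f x \<noteq> ?m x})"
    by (rule arg_cong[where f = card]) auto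
  also have "\<dots> = card {x \<in> X. g x \<noteq> ?m x} + card {x \<in> X. f x \<noteq> ?m x}"
    using assms(1) by (intro card_Un_disjoint) auto
  finally show ?thesis using 1 2 by (simp add: algebra_simps)
qed

section \<open>Lipschitz extension and the l1 metric on the grid\<close>

text \<open>McShane extension, carried out separately in each class of R: minimise f y + d x y over
  the y in S related to x.\<close>

lemma Lipschitz_extension:
  fixes d :: "'a \<Rightarrow> 'a \<Rightarrow> real"
  assumes "finite S" and "equivp R"
    and d0: "\<And>x. d x x = 0" and nonneg: "\<forall>x y. 0 \<le> d x y"
    and tri: "\<And>x y z. d x z \<le> d x y + d y z"
    and lip: "\<And>x y. x \<in> S \<Longrightarrow> y \<in> S \<Longrightarrow> R x y \<Longrightarrow> f x - f y \<le> d x y"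
  shows "\<exists>g. (\<forall>x\<in>S. g x = f x) \<and> (\<forall>x y. R x y \<longrightarrow> g x - g y \<le> d x y)"
proof -
  define N where "N x = {y \<in> S. R x y}" for x
  \<comment> \<open>A class that misses S gets the constant 0, which is Lipschitz because d is
    nonnegative.\<close>
  define g where "g x = (if N x = {} then 0 else MIN y\<in>N x. f y + d x y)" for x
  have fin: "finite (N x)" for x using assms(1) by (simp add: N_def)
  have "g x = f x" if "x \<in> S" for x
  proof -
    have x: "x \<in> N x" using that equivp_reflp[OF assms(2)] by (simp add: N_def)
    have "(MIN y\<in>N x. f y + d x y) = f x"
    proof (rule Min_eqI)
      fix v assume "v \<in> (\<lambda>y. f y + d x y) ` N x"
      then obtain y where "y \<in> S" "R x y" "v = f y + d x y" by (auto simp: N_def)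
      then show "f x \<le> v" using lip[of x y] that by simp
    qed (use fin x d0 in \<open>auto simp: image_iff intro!: bexI[of _ x]\<close>)
    then show ?thesis using x by (auto simp: g_def)
  qed
  moreover have "g x - g y \<le> d x y" if "R x y" for x y
  proof -
    have N: "N x = N y" using that assms(2) unfolding N_def equivp_def by metis
    show ?thesis
    proof (cases "N x = {}")
      case True
      then show ?thesis using N nonneg by (simp add: g_def)
    next
      case False
      then have "(MIN z\<in>N y. f z + d y z) \<in> (\<lambda>z. f z + d y z) ` N y"
        using fin N by (intro Min_in) auto
      then obtain z where z: "z \<in> N y" "(MIN z\<in>N y. f z + d y z) = f z + d y z" by auto
      have "(MIN z\<in>N x. f z + d x z) \<le> f z + d x z"
        using fin z N by (intro Min_le) auto
      then show ?thesis using False N z tri[of x z y] by (simp add: g_def)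
    qed
  qed
  ultimately show ?thesis by blast
qed

definition l1 :: "nat \<Rightarrow> point \<Rightarrow> point \<Rightarrow> real"
  where "l1 n x y = (\<Sum>i\<in>{1..n}. \<bar>real (x i) - real (y i)\<bar>)"

definition agree :: "nat set \<Rightarrow> point \<Rightarrow> point \<Rightarrow> bool"
  where "agree J x y \<longleftrightarrow> (\<forall>i\<in>J. x i = y i)"

lemma l1_nonneg: "0 \<le> l1 n x y"
  by (simp add: l1_def sum_nonneg)

lemma l1_commute: "l1 n x y = l1 n y x"
  by (simp add: l1_def abs_minus_commute)

lemma l1_self: "l1 n x x = 0"
  by (simp add: l1_def)

lemma l1_triangle: "l1 n x z \<le> l1 n x y + l1 n y z"
  unfolding l1_def sum.distrib[symmetric] by (rule sum_mono) linarith

lemma l1_upd: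
  assumes "j \<in> {1..n}"
  shows "l1 n (x(j := c)) (y(j := c')) + \<bar>real (x j) - real (y j)\<bar>
    = l1 n x y + \<bar>real c - real c'\<bar>"
proof -
  have "(\<Sum>i\<in>{1..n} - {j}. \<bar>real ((x(j := c)) i) - real ((y(j := c')) i)\<bar>)
    = (\<Sum>i\<in>{1..n} - {j}. \<bar>real (x i) - real (y i)\<bar>)"
    by (rule sum.cong) auto
  then show ?thesis
    unfolding l1_def sum.remove[OF finite_atLeastAtMost assms] by simp
qed

lemma l1_agree:
  assumes "j \<in> {1..n}" "agree ({1..n} - {j}) x y"
  shows "l1 n x y = \<bar>real (x j) - real (y j)\<bar>"
proof -
  have "(\<Sum>i\<in>{1..n} - {j}. \<bar>real (x i) - real (y i)\<bar>) = 0"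
    using assms(2) by (intro sum.neutral) (simp add: agree_def)
  then show ?thesis unfolding l1_def sum.remove[OF finite_atLeastAtMost assms(1)] by simp
qed

lemma symp_agree: "symp (agree J)"
  by (auto simp: symp_def agree_def)

lemma equivp_agree: "equivp (agree J)"
  by (rule equivpI) (auto simp: reflp_def symp_def transp_def agree_def)

lemma grid_coord: "x \<in> grid n k \<Longrightarrow> j \<in> {1..n} \<Longrightarrow> x j \<in> {1..k}"
  by (auto simp: grid_def PiE_def Pi_def)

lemma grid_upd: "x \<in> grid n k \<Longrightarrow> j \<in> {1..n} \<Longrightarrow> c \<in> {1..k} \<Longrightarrow> x(j := c) \<in> grid n k"
  by (auto simp: grid_def PiE_def Pi_def extensional_def)

lemma grid_agree_eq: "x \<in> grid n k \<Longrightarrow> y \<in> grid n k \<Longrightarrow> agree {1..n} x y \<Longrightarrow> x = y"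
  unfolding grid_def agree_def by (rule PiE_ext) auto

lemma card_grid: "card (grid n k) = k ^ n"
  by (simp add: grid_def card_PiE)

text \<open>All layers are identified with the layer x j = 1, so that functions on different layers
  share a domain and can be compared.\<close>

lemma sum_grid_layers:
  assumes "j \<in> {1..n}"
  shows "(\<Sum>x\<in>grid n k. F x) = (\<Sum>c\<in>{1..k}. \<Sum>y\<in>{x\<in>grid n k. x j = 1}. F (y(j := c)))"
  unfolding sum.cartesian_product
proof (rule sum.reindex_bij_witness[where i = "\<lambda>(c, y). y(j := c)" and j = "\<lambda>x. (x j, x(j := 1))"])
  fix x assume "x \<in> grid n k"
  then show "(x j, x(j := 1)) \<in> {1..k} \<times> {x \<in> grid n k. x j = 1}"
    using grid_coord[OF _ assms, of x k] grid_upd[OF _ assms, of x k 1] by auto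
next
  fix p :: "nat \<times> point" assume p: "p \<in> {1..k} \<times> {x \<in> grid n k. x j = 1}"
  then show "(case p of (c, y) \<Rightarrow> y(j := c)) \<in> grid n k"
    using grid_upd[OF _ assms] by auto
  show "((case p of (c, y) \<Rightarrow> y(j := c)) j, (case p of (c, y) \<Rightarrow> y(j := c))(j := 1)) = p"
    using p by (cases p) auto
qed auto

section \<open>Dimension reduction\<close>

text \<open>Agreement in coordinate j decouples the layers, so the right-hand side is at least the
  sum of the layer gaps. When f is Lipschitz in direction j, near-optimal layer pairs can be made to
  fit together across layers, which gives a pair feasible for J of nearly that total width.\<close>

lemma gap_agree_insert:
  assumes j: "j \<in> {1..n}" and t: "0 \<le> t"
    and line: "\<And>x y. x \<in> grid n k \<Longrightarrow> y \<in> grid n k \<Longrightarrow> agree ({1..n} - {j}) x y \<Longrightarrow>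
      f x - f y \<le> \<bar>real (x j) - real (y j)\<bar>"
  shows "gap (agree J) (l1 n) (grid n k) t f \<le> gap (agree (insert j J)) (l1 n) (grid n k) t f"
proof -
  let ?R = "agree (insert j J)" and ?d = "l1 n"
  define Y where "Y = {x \<in> grid n k. x j = 1}"
  have finY: "finite Y" using finite_grid by (simp add: Y_def)
  have nn: "\<forall>x y. 0 \<le> ?d x y" by (simp add: l1_nonneg)
  define F where "F c y = f (y(j := c))" for c and y :: point
  have layers: "width (grid n k) a b
      = (\<Sum>c\<in>{1..k}. width Y (\<lambda>y. a (y(j := c))) (\<lambda>y. b (y(j := c))))" for a b
    unfolding width_def Y_def by (rule sum_grid_layers[OF j])
  have lower: "(\<Sum>c\<in>{1..k}. gap ?R ?d Y t (F c)) \<le> gap ?R ?d (grid n k) t f"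
  proof (rule gap_greatest[OF finite_grid nn t])
    fix a b assume sw: "sandwich ?R ?d (grid n k) t f a b"
    have "sandwich ?R ?d Y t (F c) (\<lambda>y. a (y(j := c))) (\<lambda>y. b (y(j := c)))" if c: "c \<in> {1..k}" for c
      unfolding sandwich_def
    proof (intro conjI ballI impI)
      fix x assume "x \<in> Y"
      then have "x(j := c) \<in> grid n k" using grid_upd[OF _ j c] by (simp add: Y_def)
      then show "a (x(j := c)) \<le> F c x" "F c x \<le> b (x(j := c))"
        using sw by (auto simp: sandwich_def F_def)
    next
      fix x y assume xy: "x \<in> Y" "y \<in> Y" "?R x y"
      then have "x(j := c) \<in> grid n k" "y(j := c) \<in> grid n k" "?R (x(j := c)) (y(j := c))"
        using grid_upd[OF _ j c] by (auto simp: Y_def agree_def)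
      then have "a (x(j := c)) - b (y(j := c)) \<le> ?d (x(j := c)) (y(j := c)) + t"
        using sw by (simp add: sandwich_def)
      then show "a (x(j := c)) - b (y(j := c)) \<le> ?d x y + t"
        using l1_upd[OF j, of x c y c] xy by (simp add: Y_def)
    qed
    then show "(\<Sum>c\<in>{1..k}. gap ?R ?d Y t (F c)) \<le> width (grid n k) a b"
      unfolding layers by (intro sum_mono gap_le_width) auto
  qed
  have upper: "gap (agree J) ?d (grid n k) t f \<le> (\<Sum>c\<in>{1..k}. gap ?R ?d Y t (F c))"
  proof (rule field_le_epsilon)
    fix e :: real assume e: "0 < e"
    \<comment> \<open>Each of the k layers loses k * \<delta>, in total at most e; the + 1 keeps the
      denominator positive.\<close>
    define \<delta> where "\<delta> = e / (real k * real k + 1)"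
    have \<delta>: "0 < \<delta>" "real k * real k * \<delta> \<le> e"
      using e by (auto simp: \<delta>_def field_simps add_pos_nonneg)
    have "\<forall>c. \<exists>a b. sandwich ?R ?d Y t (F c) a b \<and> width Y a b < gap ?R ?d Y t (F c) + \<delta>"
      using gap_approx[OF finY nn t \<delta>(1)] by metis
    then obtain A B where AB: "\<And>c. sandwich ?R ?d Y t (F c) (A c) (B c)"
      "\<And>c. width Y (A c) (B c) < gap ?R ?d Y t (F c) + \<delta>" by metis
    define s where "s c c' = \<bar>real c - real c'\<bar>" for c c' :: nat
    \<comment> \<open>The shifted pairs from all layers are combined so that \<open>a\<close> and \<open>b\<close> become \<open>1\<close>-Lipschitz
      in direction \<open>j\<close>; line-Lipschitzness of \<open>f\<close> keeps them near-optimal.\<close>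
    define u where "u c y = (MIN c'\<in>{1..k}. A c' y + s c c')" for c y
    define v where "v c y = (MIN c'\<in>{1..k}. B c' y + s c c')" for c y
    have uv: "sandwich ?R ?d Y t (F c) (u c) (v c) \<and>
      width Y (u c) (v c) \<le> gap ?R ?d Y t (F c) + real (card {1..k}) * \<delta>" if c: "c \<in> {1..k}" for c
    proof -
      \<comment> \<open>The vanishing term \<open>s c c\<close> makes the layer function a member of
        the family indexed by c'; line-Lipschitzness makes it the smallest member.\<close>
      have "sandwich ?R ?d Y t (\<lambda>y. F c y + s c c) (u c) (v c) \<and>
        width Y (u c) (v c) \<le> gap ?R ?d Y t (\<lambda>y. F c y + s c c) + real (card {1..k}) * \<delta>"
        unfolding u_def v_def
      proof (rule sandwich_Min[where F = "\<lambda>c' y. F c' y + s c c'"])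
        fix c' assume c': "c' \<in> {1..k}"
        show "sandwich ?R ?d Y t (\<lambda>y. F c' y + s c c') (\<lambda>y. A c' y + s c c') (\<lambda>y. B c' y + s c c')"
          by (rule sandwich_add_const[OF AB(1)])
        show "width Y (\<lambda>y. A c' y + s c c') (\<lambda>y. B c' y + s c c')
            \<le> gap ?R ?d Y t (\<lambda>y. F c' y + s c c') + \<delta>"
          using AB(2)[of c'] gap_add_const_ge[OF finY nn t, of ?R "F c'" "s c c'"]
          by (simp add: width_def)
        fix y assume "y \<in> Y"
        then have "f (y(j := c)) - f (y(j := c')) \<le> \<bar>real ((y(j := c)) j) - real ((y(j := c')) j)\<bar>"
          using c c' grid_upd[OF _ j] by (intro line) (auto simp: Y_def agree_def)
        then show "F c y + s c c \<le> F c' y + s c c'" by (simp add: F_def s_def)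
      qed (use c in auto)
      then show ?thesis by (simp add: s_def)
    qed
    define a where "a x = u (x j) (x(j := 1))" for x
    define b where "b x = v (x j) (x(j := 1))" for x
    have base: "x(j := 1) \<in> Y" "x j \<in> {1..k}" if "x \<in> grid n k" for x
      using grid_coord[OF that j] grid_upd[OF that j, of 1] by (auto simp: Y_def)
    have sw: "sandwich (agree J) ?d (grid n k) t f a b"
      unfolding sandwich_def
    proof (intro conjI ballI impI)
      fix x assume x: "x \<in> grid n k"
      have "u (x j) (x(j := 1)) \<le> F (x j) (x(j := 1))" "F (x j) (x(j := 1)) \<le> v (x j) (x(j := 1))"
        using uv[OF base(2)[OF x]] base(1)[OF x] by (auto simp: sandwich_def)
      then show "a x \<le> f x" "f x \<le> b x" by (auto simp: a_def b_def F_def)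
    next
      fix x y assume x: "x \<in> grid n k" and y: "y \<in> grid n k" and R: "agree J x y"
      \<comment> \<open>The layer c that attains the minimum for b y also bounds a x. The triangle
        inequality for s then supplies the distance in direction j that is lost by moving both
        points to layer 1.\<close>
      have "b y \<in> (\<lambda>c'. B c' (y(j := 1)) + s (y j) c') ` {1..k}"
        unfolding b_def v_def using base(2)[OF y] by (intro Min_in) auto
      then obtain c where c: "c \<in> {1..k}" "b y = B c (y(j := 1)) + s (y j) c" by auto
      have "a x \<le> A c (x(j := 1)) + s (x j) c"
        unfolding a_def u_def using c by (intro Min_le) auto
      moreover have "A c (x(j := 1)) - B c (y(j := 1)) \<le> ?d (x(j := 1)) (y(j := 1)) + t"
        using AB(1)[of c] base(1)[OF x] base(1)[OF y] R by (auto simp: sandwich_def agree_def)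
      ultimately show "a x - b y \<le> ?d x y + t"
        using c(2) l1_upd[OF j, of x 1 y 1] by (simp add: s_def)
    qed
    have "width (grid n k) a b = (\<Sum>c\<in>{1..k}. width Y (u c) (v c))"
      unfolding layers by (intro sum.cong) (auto simp: width_def a_def b_def Y_def fun_upd_idem)
    also have "\<dots> \<le> (\<Sum>c\<in>{1..k}. gap ?R ?d Y t (F c) + real (card {1..k}) * \<delta>)"
      using uv by (intro sum_mono) auto
    also have "\<dots> \<le> (\<Sum>c\<in>{1..k}. gap ?R ?d Y t (F c)) + e"
      using \<delta>(2) by (simp add: sum.distrib algebra_simps)
    finally show "gap (agree J) ?d (grid n k) t f \<le> (\<Sum>c\<in>{1..k}. gap ?R ?d Y t (F c)) + e"
      using gap_le_width[OF sw] by linarith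
  qed
  from lower upper show ?thesis by linarith
qed

lemma gap_agree_all:
  assumes "0 \<le> t"
  shows "gap (agree {1..n}) (l1 n) (grid n k) t f = 0"
proof (rule antisym)
  have "sandwich (agree {1..n}) (l1 n) (grid n k) t f f f"
    unfolding sandwich_def using assms by (force dest: grid_agree_eq simp: l1_self)
  from gap_le_width[OF this] show "gap (agree {1..n}) (l1 n) (grid n k) t f \<le> 0"
    by (simp add: width_def)
  show "0 \<le> gap (agree {1..n}) (l1 n) (grid n k) t f"
    using assms by (intro gap_greatest) (auto simp: finite_grid l1_nonneg width_nonneg)
qed

text \<open>Redefine f on V so that it becomes Lipschitz in direction j everywhere; for the new g,
  adding j to J changes no gap. Passing from f to g for J, and from g back to f for
  \<open>insert j J\<close>, costs t * card V each.\<close>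

lemma gap_drop_insert:
  assumes j: "j \<in> {1..n}" and t: "0 \<le> t" and V: "V \<subseteq> grid n k"
    and line: "\<And>x y. x \<in> grid n k - V \<Longrightarrow> y \<in> grid n k - V \<Longrightarrow> agree ({1..n} - {j}) x y \<Longrightarrow>
      f x - f y \<le> \<bar>real (x j) - real (y j)\<bar>"
  shows "gap (agree J) (l1 n) (grid n k) 0 f - gap (agree J) (l1 n) (grid n k) t f
    \<le> gap (agree (insert j J)) (l1 n) (grid n k) 0 f - gap (agree (insert j J)) (l1 n) (grid n k) t f
      + 2 * t * real (card V)"
proof -
  let ?G = "\<lambda>J t f. gap (agree J) (l1 n) (grid n k) t f"
  have nn: "\<forall>x y. 0 \<le> l1 n x y" "\<forall>x y. l1 n x y = l1 n y x"
    using l1_nonneg l1_commute by auto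
  have "\<exists>g. (\<forall>x\<in>grid n k - V. g x = f x) \<and>
    (\<forall>x y. agree ({1..n} - {j}) x y \<longrightarrow> g x - g y \<le> l1 n x y)"
    by (rule Lipschitz_extension)
       (use line l1_agree[OF j] in \<open>auto simp: finite_grid equivp_agree l1_self l1_nonneg l1_triangle\<close>)
  then obtain g where g: "\<And>x. x \<in> grid n k - V \<Longrightarrow> g x = f x"
    "\<And>x y. agree ({1..n} - {j}) x y \<Longrightarrow> g x - g y \<le> l1 n x y" by blast
  have eq: "?G J s g = ?G (insert j J) s g" if "0 \<le> s" for s
  proof (rule antisym)
    show "?G J s g \<le> ?G (insert j J) s g"
      using g(2) l1_agree[OF j] by (intro gap_agree_insert[OF j that]) metis
    show "?G (insert j J) s g \<le> ?G J s g"
      by (rule gap_mono_rel[OF finite_grid nn(1) that]) (simp add: agree_def)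
  qed
  have "{x \<in> grid n k. f x \<noteq> g x} \<subseteq> V" "{x \<in> grid n k. g x \<noteq> f x} \<subseteq> V"
    using g(1) by force+
  then have "card {x \<in> grid n k. f x \<noteq> g x} \<le> card V" "card {x \<in> grid n k. g x \<noteq> f x} \<le> card V"
    using finite_subset[OF V finite_grid] by (auto intro: card_mono)
  then have c: "t * real (card {x \<in> grid n k. f x \<noteq> g x}) \<le> t * real (card V)"
    "t * real (card {x \<in> grid n k. g x \<noteq> f x}) \<le> t * real (card V)"
    using t by (auto intro: mult_left_mono)
  note perturb = gap_drop_perturb[OF finite_grid nn(1) t symp_agree nn(2)]
  have "?G J 0 f - ?G J t f \<le> ?G J 0 g - ?G J t g + t * real (card V)"
    using perturb[where f = f and g = g] c(1) by (rule order_trans[OF _ add_left_mono])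
  moreover have "?G (insert j J) 0 g - ?G (insert j J) t g
      \<le> ?G (insert j J) 0 f - ?G (insert j J) t f + t * real (card V)"
    using perturb[where f = g and g = f] c(2) by (rule order_trans[OF _ add_left_mono])
  ultimately show ?thesis using eq[of 0] eq[OF t] by simp
qed

lemma gap_drop_le:
  assumes t: "0 \<le> t" and V: "\<And>i. i \<in> {1..n} \<Longrightarrow> V i \<subseteq> grid n k"
    and line: "\<And>i x y. i \<in> {1..n} \<Longrightarrow> x \<in> grid n k - V i \<Longrightarrow> y \<in> grid n k - V i \<Longrightarrow>
      agree ({1..n} - {i}) x y \<Longrightarrow> f x - f y \<le> \<bar>real (x i) - real (y i)\<bar>"
  shows "gap (agree {}) (l1 n) (grid n k) 0 f - gap (agree {}) (l1 n) (grid n k) t f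
    \<le> 2 * t * (\<Sum>i\<in>{1..n}. real (card (V i)))"
proof -
  have "gap (agree {}) (l1 n) (grid n k) 0 f - gap (agree {}) (l1 n) (grid n k) t f
    \<le> gap (agree J) (l1 n) (grid n k) 0 f - gap (agree J) (l1 n) (grid n k) t f
      + 2 * t * (\<Sum>i\<in>J. real (card (V i)))" if "J \<subseteq> {1..n}" for J
    using finite_subset[OF that finite_atLeastAtMost] that
  proof (induction J)
    case (insert j J)
    then have j: "j \<in> {1..n}" by auto
    show ?case
      using insert gap_drop_insert[of j n t "V j" k f J, OF j t V[OF j] line[OF j]] by (simp add: algebra_simps)
  qed simp
  from this[OF order_refl] show ?thesis
    unfolding gap_agree_all[OF order_refl] gap_agree_all[OF t] by simp
qed

theorem dimension_reduction:
  assumes V: "\<And>i. i \<in> {1..n} \<Longrightarrow> V i \<subseteq> grid n k"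
    and line: "\<And>i x y. i \<in> {1..n} \<Longrightarrow> x \<in> grid n k - V i \<Longrightarrow> y \<in> grid n k - V i \<Longrightarrow>
      agree ({1..n} - {i}) x y \<Longrightarrow> f x - f y \<le> \<bar>real (x i) - real (y i)\<bar>"
  obtains U where "U \<subseteq> grid n k" "card U \<le> 4 * (\<Sum>i\<in>{1..n}. card (V i))"
    "\<And>x y. x \<in> grid n k - U \<Longrightarrow> y \<in> grid n k - U \<Longrightarrow> f x - f y \<le> l1 n x y"
proof -
  define E where "E = {f x - f y - l1 n x y | x y. x \<in> grid n k \<and> y \<in> grid n k \<and> l1 n x y < f x - f y}"
  have "finite E"
  proof (rule finite_subset)
    show "E \<subseteq> (\<lambda>(x, y). f x - f y - l1 n x y) ` (grid n k \<times> grid n k)"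
      unfolding E_def by auto
  qed (simp add: finite_grid)
  \<comment> \<open>No constraint is violated by a positive amount below t; the 1 covers the case
    without violations.\<close>
  define t where "t = Min (insert 1 E)"
  have t: "0 < t" unfolding t_def using \<open>finite E\<close> by (auto simp: E_def)
  have t_le: "f x - f y \<le> l1 n x y"
    if "x \<in> grid n k" "y \<in> grid n k" "f x - f y < l1 n x y + t" for x y
  proof (rule ccontr)
    assume "\<not> f x - f y \<le> l1 n x y"
    then have "f x - f y - l1 n x y \<in> E" using that unfolding E_def by fastforce
    then have "t \<le> f x - f y - l1 n x y" using \<open>finite E\<close> by (simp add: t_def)
    then show False using that by linarith
  qed
  have nn: "\<forall>x y. 0 \<le> l1 n x y" by (simp add: l1_nonneg)
  \<comment> \<open>The tolerance t / 4 leaves only + 1 in the final bound on 2 * card U, and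
    integrality removes it.\<close>
  obtain a b where sw: "sandwich (agree {}) (l1 n) (grid n k) 0 f a b"
    and wd: "width (grid n k) a b < gap (agree {}) (l1 n) (grid n k) 0 f + t / 4"
    using gap_approx[OF finite_grid nn order_refl, of "t / 4"] t by (metis divide_pos_pos zero_less_numeral)
  \<comment> \<open>Off U both bounds are within t / 2 of f, so f x - f y exceeds a x - b y by less
    than t.\<close>
  define U where "U = {x \<in> grid n k. t / 2 \<le> f x - a x \<or> t / 2 \<le> b x - f x}"
  have swD: "a x \<le> f x" "f x \<le> b x" if "x \<in> grid n k" for x
    using sw that by (auto simp: sandwich_def)
  have swR: "a x - b y \<le> l1 n x y" if "x \<in> grid n k" "y \<in> grid n k" for x y
    using sw that by (auto simp: sandwich_def agree_def)
  \<comment> \<open>Moving both bounds by t / 2 towards f, but not past it, uses at most the slack t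
    and saves at least t / 2 of width at every point of U.\<close>
  let ?a = "\<lambda>x. min (f x) (a x + t / 2)" and ?b = "\<lambda>x. max (f x) (b x - t / 2)"
  have "sandwich (agree {}) (l1 n) (grid n k) t f ?a ?b"
    unfolding sandwich_def
  proof (intro conjI ballI impI)
    fix x y assume "x \<in> grid n k" "y \<in> grid n k"
    then show "?a x - ?b y \<le> l1 n x y + t" using swR[of x y] by linarith
  qed auto
  then have 1: "gap (agree {}) (l1 n) (grid n k) t f \<le> width (grid n k) ?a ?b"
    by (rule gap_le_width)
  have "width (grid n k) ?a ?b \<le> (\<Sum>x\<in>grid n k. (b x - a x) - (if x \<in> U then t / 2 else 0))"
    unfolding width_def
  proof (rule sum_mono)
    fix x assume x: "x \<in> grid n k"
    show "?b x - ?a x \<le> (b x - a x) - (if x \<in> U then t / 2 else 0)"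
      using swD[OF x] x t by (auto simp: U_def min_def max_def)
  qed
  also have "\<dots> = width (grid n k) a b - real (card U) * (t / 2)"
    by (simp add: sum_subtractf width_def sum.If_cases finite_grid U_def Int_def)
  finally have "real (card U) * (t / 2)
      \<le> gap (agree {}) (l1 n) (grid n k) 0 f - gap (agree {}) (l1 n) (grid n k) t f + t / 4"
    using 1 wd by linarith
  also have "\<dots> \<le> 2 * t * (\<Sum>i\<in>{1..n}. real (card (V i))) + t / 4"
    using gap_drop_le[of t n V k f] t V line by auto
  finally have "t * (2 * real (card U)) \<le> t * (8 * real (\<Sum>i\<in>{1..n}. card (V i)) + 1)"
    by (simp add: algebra_simps)
  then have "2 * real (card U) \<le> 8 * real (\<Sum>i\<in>{1..n}. card (V i)) + 1"
    using t by (simp only: mult_le_cancel_left_pos)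
  then have "card U \<le> 4 * (\<Sum>i\<in>{1..n}. card (V i))" by linarith
  moreover have "f x - f y \<le> l1 n x y" if "x \<in> grid n k - U" "y \<in> grid n k - U" for x y
  proof -
    have "f x - a x < t / 2" "b y - f y < t / 2" using that by (auto simp: U_def)
    then show ?thesis using swR[of x y] that by (intro t_le) auto
  qed
  ultimately show ?thesis using that[of U] by (auto simp: U_def)
qed

section \<open>Dyadic midpoints on a line\<close>

text \<open>The midpoint of the dyadic block of length \<open>2 ^ Suc l\<close> containing \<open>c\<close>.\<close>

definition hub :: "nat \<Rightarrow> nat \<Rightarrow> nat"
  where "hub l c = c div 2 ^ Suc l * 2 ^ Suc l + 2 ^ l"

text \<open>For k \<ge> 1 this counts the l with \<open>2 ^ l\<close> \<le> k; a hub of a higher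
  level exceeds k.\<close>

definition levels :: "nat \<Rightarrow> nat"
  where "levels k = nat \<lfloor>log 2 (real k)\<rfloor> + 1"

text \<open>A midpoint of a low level may still exceed k; the filter keeps the queries inside the
  grid.\<close>

definition hubs :: "nat \<Rightarrow> nat \<Rightarrow> nat list"
  where "hubs k c = filter (\<lambda>h. h \<in> {1..k}) (map (\<lambda>l. hub l c) [0..<levels k])"

text \<open>In the smallest dyadic block containing both, i and j lie in different halves, and the
  hub is the first element of the right half. Hence it is strictly above i but may equal j.\<close>

lemma hub_between:
  assumes "i < j"
  obtains l where "hub l i = hub l j" "i < hub l i" "hub l i \<le> j"
proof -
  define L where "L = (LEAST L. i div 2 ^ L = j div 2 ^ L)"
  \<comment> \<open>A common block exists: at level j both quotients are 0.\<close>
  have "i < 2 ^ j" "j < 2 ^ j" using assms less_exp[of j] by linarith+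
  then have "i div 2 ^ j = j div 2 ^ j" by simp
  then have L: "i div 2 ^ L = j div 2 ^ L" unfolding L_def by (rule LeastI)
  have "L \<noteq> 0" using L assms by (intro notI) simp
  then obtain l where l: "L = Suc l" by (cases L) auto
  then have ne: "i div 2 ^ l \<noteq> j div 2 ^ l"
    using not_less_Least[of l "\<lambda>L. i div 2 ^ L = j div 2 ^ L"] by (simp add: L_def)
  define q where "q = i div 2 ^ Suc l"
  have eq: "i div 2 ^ l div 2 = q" "j div 2 ^ l div 2 = q"
    using L l by (simp_all add: q_def div_mult2_eq[symmetric] mult.commute)
  moreover have "i div 2 ^ l \<le> j div 2 ^ l" using assms by (simp add: div_le_mono)
  moreover have "u = 2 * q \<and> w = 2 * q + 1"
    if "u div 2 = q" "w div 2 = q" "u \<le> w" "u \<noteq> w" for u w :: nat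
    using that by presburger
  ultimately have ij: "i div 2 ^ l = 2 * q" "j div 2 ^ l = 2 * q + 1" using ne by blast+
  have h: "hub l i = (2 * q + 1) * 2 ^ l" by (simp add: hub_def q_def algebra_simps)
  have "i < (i div 2 ^ l + 1) * 2 ^ l" using dividend_less_div_times[of "2 ^ l" i] by simp
  moreover have "j div 2 ^ l * 2 ^ l \<le> j" by simp
  moreover have "hub l i = hub l j" using L l by (simp add: hub_def)
  ultimately show ?thesis using that[of l] h ij by simp
qed

text \<open>The separating hub is at most j \<le> k and at least \<open>2 ^ l\<close>, so its level
  is below \<open>levels k\<close> and the filter keeps it.\<close>

lemma hubs_between:
  assumes "i < j" "j \<le> k"
  obtains w where "w \<in> set (hubs k i)" "w \<in> set (hubs k j)" "i < w" "w \<le> j"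
proof -
  obtain l where l: "hub l i = hub l j" "i < hub l i" "hub l i \<le> j"
    using hub_between[OF assms(1)] by blast
  have "2 ^ l \<le> hub l i" by (simp add: hub_def)
  then have "2 ^ l \<le> k" using l assms by linarith
  then have "real (2 ^ l) \<le> real k" by (simp only: of_nat_le_iff)
  then have "real l \<le> log 2 (real k)" by (simp add: le_log_of_power)
  then have "l < levels k" unfolding levels_def by linarith
  moreover have "hub l i \<in> {1..k}" using l assms by auto
  ultimately have "hub l i \<in> set (hubs k i)" "hub l j \<in> set (hubs k j)"
    using l(1) by (simp_all add: hubs_def image_iff) (metis atLeast0LessThan lessThan_iff)+
  then show ?thesis using that l by metis
qed

lemma set_hubs: "set (hubs k c) \<subseteq> {1..k}"
  by (auto simp: hubs_def)

lemma length_hubs: 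
  assumes "1 \<le> k"
  shows "real (length (hubs k c)) \<le> log 2 (2 * real k)"
proof -
  have "length (hubs k c) \<le> levels k"
    unfolding hubs_def by (metis diff_zero length_filter_le length_map length_upt)
  moreover have "0 \<le> log 2 (real k)" using assms by simp
  then have "real (levels k) \<le> log 2 (real k) + 1" unfolding levels_def by linarith
  moreover have "log 2 (2 * real k) = 1 + log 2 (real k)" using assms by (simp add: log_mult)
  ultimately show ?thesis by linarith
qed

section \<open>Slope checks along a line\<close>

text \<open>Vacuous unless x i \<le> y i, so \<open>passes\<close> checks both orders. For \<beta> =
  \<infinity> and x i = y i the product is 0 in \<open>ereal\<close>; this is harmless in
  \<open>passes\<close>, where the two points then coincide.\<close>

definition slope_ok :: "real \<Rightarrow> ereal \<Rightarrow> (point \<Rightarrow> real) \<Rightarrow> nat \<Rightarrow> point \<Rightarrow> point \<Rightarrow> bool"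
  where "slope_ok \<alpha> \<beta> f i x y \<longleftrightarrow> (x i \<le> y i \<longrightarrow>
    \<alpha> * (real (y i) - real (x i)) \<le> f y - f x \<and>
    ereal (f y - f x) \<le> \<beta> * ereal (real (y i) - real (x i)))"

definition passes :: "nat \<Rightarrow> real \<Rightarrow> ereal \<Rightarrow> (point \<Rightarrow> real) \<Rightarrow> nat \<times> point \<Rightarrow> bool"
  where "passes k \<alpha> \<beta> f = (\<lambda>(i, x). \<forall>h\<in>set (hubs k (x i)).
    slope_ok \<alpha> \<beta> f i x (x(i := h)) \<and> slope_ok \<alpha> \<beta> f i (x(i := h)) x)"

text \<open>Unit steps from x upwards are summed by induction on their number; for h below x i the
  claim is vacuous.\<close>

lemma ab_lipschitz_slope_ok:
  assumes f: "ab_lipschitz n k \<alpha> \<beta> f" and "ereal \<alpha> < \<beta>" and i: "i \<in> {1..n}"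
    and x: "x \<in> grid n k" and h: "h \<in> {1..k}"
  shows "slope_ok \<alpha> \<beta> f i x (x(i := h))"
proof -
  have "\<alpha> * real m \<le> f (x(i := x i + m)) - f x \<and>
    ereal (f (x(i := x i + m)) - f x) \<le> \<beta> * ereal (real m)" if "x i + m \<le> k" for m
    using that
  proof (induction m)
    case (Suc m)
    let ?y = "x(i := x i + m)" and ?z = "x(i := x i + Suc m)"
    have "x i \<in> {1..k}" using grid_coord[OF x i] .
    then have "?y \<in> grid n k" "?z \<in> grid n k" using Suc.prems by (auto intro!: grid_upd[OF x i])
    moreover have "?z = ?y(i := ?y i + 1)" by simp
    ultimately have "\<alpha> \<le> f ?z - f ?y" "ereal (f ?z - f ?y) \<le> \<beta>"
      using f i unfolding ab_lipschitz_def by blast+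
    moreover have "\<alpha> * real m \<le> f ?y - f x" "ereal (f ?y - f x) \<le> \<beta> * ereal (real m)"
      using Suc by (simp_all del: fun_upd_apply)
    ultimately show ?case using assms(2)
      by (cases \<beta>) (simp_all add: algebra_simps del: fun_upd_apply)
  qed (simp add: zero_ereal_def[symmetric])
  from this[of "h - x i"] show ?thesis
    using h by (auto simp: slope_ok_def of_nat_diff)
qed

lemma ab_lipschitz_passes:
  assumes "ab_lipschitz n k \<alpha> \<beta> f" "ereal \<alpha> < \<beta>" "p \<in> {1..n} \<times> grid n k"
  shows "passes k \<alpha> \<beta> f p"
proof -
  obtain i x where p: "p = (i, x)" "i \<in> {1..n}" "x \<in> grid n k" using assms(3) by auto
  have "slope_ok \<alpha> \<beta> f i x (x(i := h)) \<and> slope_ok \<alpha> \<beta> f i (x(i := h)) x"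
    if "h \<in> set (hubs k (x i))" for h
  proof -
    have h: "h \<in> {1..k}" using that set_hubs by blast
    have "slope_ok \<alpha> \<beta> f i (x(i := h)) ((x(i := h))(i := x i))"
      by (intro ab_lipschitz_slope_ok[OF assms(1,2) p(2)] grid_upd grid_coord[OF p(3,2)] p h)
    then show ?thesis using ab_lipschitz_slope_ok[OF assms(1,2) p(2,3) h] by simp
  qed
  then show ?thesis by (simp add: passes_def p(1))
qed

lemma finite_upper_slope:
  assumes "ereal \<alpha> < \<beta>"
  obtains B where "\<alpha> < B" "ereal B \<le> \<beta>"
    "\<And>i x y. x \<in> grid n k \<Longrightarrow> y \<in> grid n k \<Longrightarrow> slope_ok \<alpha> \<beta> f i x y \<Longrightarrow> x i < y i \<Longrightarrow>
      f y - f x \<le> B * (real (y i) - real (x i))"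
proof (cases \<beta>)
  case (real B)
  then show ?thesis using that[of B] assms by (simp add: slope_ok_def)
next
  case PInf
  define M where "M = (\<Sum>x\<in>grid n k. \<bar>f x\<bar>)"
  have M: "\<bar>f x\<bar> \<le> M" if "x \<in> grid n k" for x
    unfolding M_def using that finite_grid by (intro member_le_sum) auto
  have "0 \<le> M" by (simp add: M_def sum_nonneg)
  \<comment> \<open>\<alpha> + 1 secures \<alpha> < B, and 2 * M bounds every difference of f on the
    grid, even over a single unit step.\<close>
  define B where "B = max (\<alpha> + 1) (2 * M)"
  have B: "\<alpha> < B" "2 * M \<le> B" by (auto simp: B_def)
  have "f y - f x \<le> B * (real (y i) - real (x i))"
    if "x \<in> grid n k" "y \<in> grid n k" "x i < y i" for i x y
  proof -
    have "B * 1 \<le> B * (real (y i) - real (x i))"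
      using that(3) \<open>0 \<le> M\<close> B(2) by (intro mult_left_mono) auto
    then show ?thesis using M[OF that(1)] M[OF that(2)] B(2) by linarith
  qed
  then show ?thesis using that[of B] B(1) PInf by simp
qed (use assms in simp)

section \<open>From failing samples to the distance\<close>

text \<open>Deleting the points that fail in direction i leaves f with admissible slopes on all
  lines of that direction. \<open>dimension_reduction\<close> turns these sets into one set of
  points whose values are to be changed.\<close>

lemma ab_dist_le_hub_violations:
  assumes "1 \<le> k" and lt: "ereal \<alpha> < \<beta>"
  shows "ab_dist n k \<alpha> \<beta> f * real k ^ n
    \<le> 4 * real (card {p \<in> {1..n} \<times> grid n k. \<not> passes k \<alpha> \<beta> f p})"
proof -
  obtain B where B: "\<alpha> < B" "ereal B \<le> \<beta>"
    "\<And>i x y. x \<in> grid n k \<Longrightarrow> y \<in> grid n k \<Longrightarrow> slope_ok \<alpha> \<beta> f i x y \<Longrightarrow> x i < y i \<Longrightarrow>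
      f y - f x \<le> B * (real (y i) - real (x i))"
    using finite_upper_slope[OF lt] by blast
  \<comment> \<open>With c the half-length and \<gamma> the midpoint of the interval from \<alpha>
    to B, the map from f to h turns slopes in that interval into slopes between -1 and 1.\<close>
  define c where "c = (B - \<alpha>) / 2"
  define \<gamma> where "\<gamma> = (B + \<alpha>) / 2"
  define \<sigma> where "\<sigma> x = (\<Sum>i\<in>{1..n}. real (x i))" for x :: point
  define h where "h x = (f x - \<gamma> * \<sigma> x) / c" for x
  have c: "0 < c" using B(1) by (simp add: c_def)
  have c\<gamma>: "c + \<gamma> = B" "\<gamma> - c = \<alpha>" by (simp_all add: c_def \<gamma>_def field_simps)
  have \<sigma>: "\<sigma> y = \<sigma> x + (real (y i) - real (x i))" if "i \<in> {1..n}" "agree ({1..n} - {i}) x y" for i x y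
  proof -
    have "(\<Sum>j\<in>{1..n} - {i}. real (y j)) = (\<Sum>j\<in>{1..n} - {i}. real (x j))"
      using that(2) by (intro sum.cong) (auto simp: agree_def)
    then show ?thesis unfolding \<sigma>_def sum.remove[OF finite_atLeastAtMost that(1)] by simp
  qed
  have slope: "\<bar>h y - h x\<bar> \<le> real (y i) - real (x i)"
    if x: "x \<in> grid n k" and y: "y \<in> grid n k" and i: "i \<in> {1..n}" and ag: "agree ({1..n} - {i}) x y"
      and ok: "slope_ok \<alpha> \<beta> f i x y" and le: "x i \<le> y i" for x y i
  proof (cases "x i = y i")
    case True
    then have "x = y" using grid_agree_eq[OF x y] ag by (auto simp: agree_def)
    then show ?thesis by simp
  next
    case False
    let ?m = "real (y i) - real (x i)"
    have "f y - f x \<le> (c + \<gamma>) * ?m" "(\<gamma> - c) * ?m \<le> f y - f x"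
      using B(3)[OF x y ok] ok le False unfolding c\<gamma> by (auto simp: slope_ok_def)
    then have "\<bar>f y - f x - \<gamma> * ?m\<bar> \<le> ?m * c" by (simp add: abs_le_iff algebra_simps)
    moreover have "h y - h x = (f y - f x - \<gamma> * ?m) / c"
      unfolding h_def \<sigma>[OF i ag] by (simp add: diff_divide_distrib[symmetric] algebra_simps)
    ultimately show ?thesis using c by (simp add: abs_divide pos_divide_le_eq)
  qed
  define V where "V i = {x \<in> grid n k. \<not> passes k \<alpha> \<beta> f (i, x)}" for i
  have line: "\<bar>h y - h x\<bar> \<le> real (y i) - real (x i)"
    if i: "i \<in> {1..n}" and x: "x \<in> grid n k - V i" and y: "y \<in> grid n k - V i"
      and ag: "agree ({1..n} - {i}) x y" and less: "x i < y i" for i x y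
  proof -
    have "y i \<le> k" using grid_coord[of y n k i] y i by simp
    then obtain w where w: "w \<in> set (hubs k (x i))" "w \<in> set (hubs k (y i))" "x i < w" "w \<le> y i"
      using hubs_between[OF less] by blast
    \<comment> \<open>x and y were both checked against their common hub w, and the two slope bounds
      add up through z.\<close>
    define z where "z = x(i := w)"
    have wk: "w \<in> {1..k}" using w set_hubs by blast
    then have z: "z \<in> grid n k" "y(i := w) \<in> grid n k" using x y grid_upd i by (auto simp: z_def)
    have zy: "z = y(i := w)"
      using ag by (intro grid_agree_eq[OF z]) (auto simp: agree_def z_def)
    have "slope_ok \<alpha> \<beta> f i x (x(i := w))" "slope_ok \<alpha> \<beta> f i (y(i := w)) y"
      using x y w(1,2) by (auto simp: V_def passes_def)
    then have ok: "slope_ok \<alpha> \<beta> f i x z" "slope_ok \<alpha> \<beta> f i z y"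
      by (simp_all only: z_def[symmetric] zy[symmetric])
    have "agree ({1..n} - {i}) x z" by (auto simp: agree_def z_def)
    moreover have "agree ({1..n} - {i}) z y" unfolding zy by (auto simp: agree_def)
    moreover have "x i \<le> z i" "z i \<le> y i" using w(3,4) by (simp_all add: z_def)
    ultimately have "\<bar>h z - h x\<bar> \<le> real (z i) - real (x i)" "\<bar>h y - h z\<bar> \<le> real (y i) - real (z i)"
      using slope[OF _ z(1) i] slope[OF z(1) _ i] ok x y by blast+
    then show ?thesis by linarith
  qed
  have lineV: "h x - h y \<le> \<bar>real (x i) - real (y i)\<bar>"
    if i: "i \<in> {1..n}" and x: "x \<in> grid n k - V i" and y: "y \<in> grid n k - V i"
      and ag: "agree ({1..n} - {i}) x y" for i x y
  proof (cases "x i" "y i" rule: linorder_cases)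
    case equal
    then have "x = y" using grid_agree_eq[of x n k y] x y ag by (auto simp: agree_def)
    then show ?thesis by simp
  next
    case less
    then show ?thesis using line[OF i x y ag] by linarith
  next
    case greater
    have "agree ({1..n} - {i}) y x" using ag by (auto simp: agree_def)
    then show ?thesis using line[OF i y x _ greater] by linarith
  qed
  have VG: "V i \<subseteq> grid n k" for i by (auto simp: V_def)
  obtain U where U: "U \<subseteq> grid n k" "card U \<le> 4 * (\<Sum>i\<in>{1..n}. card (V i))"
    "\<And>x y. x \<in> grid n k - U \<Longrightarrow> y \<in> grid n k - U \<Longrightarrow> h x - h y \<le> l1 n x y"
    using dimension_reduction[of n V k h, OF VG lineV] by blast
  \<comment> \<open>\<open>agree {}\<close> relates all points, so h is extended from the grid
    points outside U to a globally Lipschitz function.\<close>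
  have "\<exists>g. (\<forall>x\<in>grid n k - U. g x = h x) \<and> (\<forall>x y. agree {} x y \<longrightarrow> g x - g y \<le> l1 n x y)"
    by (rule Lipschitz_extension)
       (use U in \<open>auto simp: finite_grid equivp_agree l1_self l1_nonneg l1_triangle\<close>)
  then obtain g where g: "\<And>x. x \<in> grid n k - U \<Longrightarrow> g x = h x" "\<And>x y. g x - g y \<le> l1 n x y"
    by (auto simp: agree_def)
  \<comment> \<open>Undoing the affine change gives slopes between \<alpha> and B, and F = f on the
    grid outside U.\<close>
  define F where "F x = c * g x + \<gamma> * \<sigma> x" for x
  have "ab_lipschitz n k \<alpha> \<beta> F"
    unfolding ab_lipschitz_def
  proof (intro ballI impI)
    fix x y :: point
    assume "\<exists>i\<in>{1..n}. y = x(i := x i + 1)"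
    then obtain i where i: "i \<in> {1..n}" "y = x(i := x i + 1)" by blast
    have ag: "agree ({1..n} - {i}) x y" by (auto simp: agree_def i)
    have l1: "l1 n x y = 1" "l1 n y x = 1"
      using l1_agree[OF i(1) ag] l1_commute[of n x y] by (simp_all add: i)
    have "\<sigma> y = \<sigma> x + 1" using \<sigma>[OF i(1) ag] by (simp add: i)
    then have "F y - F x = c * (g y - g x) + \<gamma>" by (simp add: F_def algebra_simps)
    moreover have "c * (g y - g x) \<le> c * 1" "c * (g x - g y) \<le> c * 1"
      using g(2)[of y x] g(2)[of x y] c l1 by (auto intro!: mult_left_mono)
    ultimately have "\<alpha> \<le> F y - F x" "F y - F x \<le> B"
      using c\<gamma> by (simp_all add: algebra_simps)
    then show "\<alpha> \<le> F y - F x \<and> ereal (F y - F x) \<le> \<beta>"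
      using B(2) by (metis ereal_less_eq(3) order_trans)
  qed
  then have "ab_dist n k \<alpha> \<beta> f \<le> real (card {x \<in> grid n k. f x \<noteq> F x}) / real k ^ n"
    unfolding ab_dist_def by (intro Min_le ab_dist_finite) auto
  then have "ab_dist n k \<alpha> \<beta> f * real k ^ n \<le> real (card {x \<in> grid n k. f x \<noteq> F x})"
    using assms(1) by (simp add: pos_le_divide_eq)
  also have "{x \<in> grid n k. f x \<noteq> F x} \<subseteq> U"
  proof
    fix x assume x: "x \<in> {x \<in> grid n k. f x \<noteq> F x}"
    show "x \<in> U"
    proof (rule ccontr)
      assume "x \<notin> U"
      then have "F x = f x" using x c by (simp add: F_def g(1) h_def)
      then show False using x by simp
    qed
  qed
  then have "card {x \<in> grid n k. f x \<noteq> F x} \<le> card U"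
    using finite_subset[OF U(1) finite_grid] by (rule card_mono[rotated])
  also have "card U \<le> 4 * card (SIGMA i:{1..n}. V i)"
    using U(2) finite_subset[OF VG finite_grid] by (subst card_SigmaI) auto
  also have "(SIGMA i:{1..n}. V i) = {p \<in> {1..n} \<times> grid n k. \<not> passes k \<alpha> \<beta> f p}"
    by (auto simp: V_def)
  finally show ?thesis by simp
qed

section \<open>Non-adaptive algorithms from predicates\<close>

primrec ask :: "'p list \<Rightarrow> (real list \<Rightarrow> bool) \<Rightarrow> 'p query_alg" where
  "ask [] D = Decide (D [])"
| "ask (x # xs) D = Query x (\<lambda>r. ask xs (\<lambda>rs. D (r # rs)))"

text \<open>The answers are reassembled into a function, unspecified off qs, so that the decision
  can be stated as a predicate on f. Repeated queries are harmless because they get equal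
  answers.\<close>

definition ask_pred :: "'p list \<Rightarrow> (('p \<Rightarrow> real) \<Rightarrow> bool) \<Rightarrow> 'p query_alg"
  where "ask_pred qs P = ask qs (\<lambda>rs. P (\<lambda>x. the (map_of (zip qs rs) x)))"

lemma queries_ask: "queries (ask qs D) f = qs"
  by (induction qs arbitrary: D) auto

lemma accepts_ask: "accepts (ask qs D) f = D (map f qs)"
  by (induction qs arbitrary: D) auto

lemma accepts_ask_pred:
  assumes "\<And>f g. (\<And>x. x \<in> set qs \<Longrightarrow> f x = g x) \<Longrightarrow> P f = P g"
  shows "accepts (ask_pred qs P) f = P f"
  unfolding ask_pred_def accepts_ask by (rule assms) (simp add: map_of_zip_map)

definition sample_queries :: "nat \<Rightarrow> nat \<times> point \<Rightarrow> point list"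
  where "sample_queries k = (\<lambda>(i, x). x # map (\<lambda>h. x(i := h)) (hubs k (x i)))"

definition hub_alg :: "nat \<Rightarrow> real \<Rightarrow> ereal \<Rightarrow> (nat \<times> point) list \<Rightarrow> point query_alg"
  where "hub_alg k \<alpha> \<beta> ps =
    ask_pred (concat (map (sample_queries k) ps)) (\<lambda>f. \<forall>p\<in>set ps. passes k \<alpha> \<beta> f p)"

lemma queries_hub_alg: "queries (hub_alg k \<alpha> \<beta> ps) f = concat (map (sample_queries k) ps)"
  by (simp add: hub_alg_def ask_pred_def queries_ask)

lemma passes_cong:
  assumes "\<And>x. x \<in> set (sample_queries k p) \<Longrightarrow> f x = g x"
  shows "passes k \<alpha> \<beta> f p = passes k \<alpha> \<beta> g p"
  using assms unfolding passes_def sample_queries_def slope_ok_def by (cases p) auto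

lemma accepts_hub_alg: "accepts (hub_alg k \<alpha> \<beta> ps) f \<longleftrightarrow> (\<forall>p\<in>set ps. passes k \<alpha> \<beta> f p)"
  unfolding hub_alg_def
proof (rule accepts_ask_pred)
  fix f g :: "point \<Rightarrow> real"
  assume "\<And>x. x \<in> set (concat (map (sample_queries k) ps)) \<Longrightarrow> f x = g x"
  then show "(\<forall>p\<in>set ps. passes k \<alpha> \<beta> f p) = (\<forall>p\<in>set ps. passes k \<alpha> \<beta> g p)"
    by (intro ball_cong refl passes_cong) auto
qed

lemma set_sample_queries:
  assumes "p \<in> {1..n} \<times> grid n k"
  shows "set (sample_queries k p) \<subseteq> grid n k"
proof -
  obtain i x where p: "p = (i, x)" "i \<in> {1..n}" "x \<in> grid n k" using assms by auto
  then show ?thesis using grid_upd[OF p(3,2)] set_hubs[of k "x i"]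
    by (auto simp: sample_queries_def simp del: fun_upd_apply)
qed

lemma length_concat_sample_queries:
  assumes "1 \<le> k"
  shows "real (length (concat (map (sample_queries k) ps)))
    \<le> real (length ps) * (1 + log 2 (2 * real k))"
proof (induction ps)
  case (Cons p ps)
  have "real (length (sample_queries k p)) \<le> 1 + log 2 (2 * real k)"
    using length_hubs[OF assms] by (auto simp: sample_queries_def split: prod.splits)
  then show ?case using Cons by (simp add: algebra_simps)
qed simp

section \<open>Independent sampling and the tester\<close>

text \<open>A uniform list of length s over S amounts to s independent uniform samples; the lists
  without a failing entry are simply counted.\<close>

lemma prob_all_pass:
  assumes "finite S" "S \<noteq> {}"
  shows "measure_pmf.prob (pmf_of_set {ps. set ps \<subseteq> S \<and> length ps = s}) {ps. \<exists>p\<in>set ps. \<not> P p}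
    = 1 - (1 - real (card {p \<in> S. \<not> P p}) / real (card S)) ^ s"
proof -
  let ?L = "{ps. set ps \<subseteq> S \<and> length ps = s}"
  obtain p where "p \<in> S" using assms(2) by blast
  then have "replicate s p \<in> ?L" by (auto simp: set_replicate_conv_if)
  then have L: "?L \<noteq> {}" "finite ?L" using finite_lists_length_eq[OF assms(1)] by (blast, simp)
  have S: "0 < card S" using assms by (simp add: card_gt_0_iff)
  have "card {p \<in> S. P p} = card (S - {p \<in> S. \<not> P p})" by (rule arg_cong[where f = card]) auto
  also have "\<dots> = card S - card {p \<in> S. \<not> P p}" using assms(1) by (intro card_Diff_subset) auto
  finally have "real (card {p \<in> S. P p}) = real (card S) - real (card {p \<in> S. \<not> P p})"
    using card_mono[OF assms(1), of "{p \<in> S. \<not> P p}"] by (simp add: of_nat_diff)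
  then have q: "real (card {p \<in> S. P p}) / real (card S)
      = 1 - real (card {p \<in> S. \<not> P p}) / real (card S)"
    using S by (simp add: field_simps)
  have "?L \<inter> {ps. \<forall>p\<in>set ps. P p} = {ps. set ps \<subseteq> {p \<in> S. P p} \<and> length ps = s}" by auto
  then have "measure_pmf.prob (pmf_of_set ?L) {ps. \<forall>p\<in>set ps. P p}
      = (real (card {p \<in> S. P p}) / real (card S)) ^ s"
    using L assms(1) by (simp add: measure_pmf_of_set card_lists_length_eq power_divide)
  moreover have "{ps. \<exists>p\<in>set ps. \<not> P p} = UNIV - {ps. \<forall>p\<in>set ps. P p}" by auto
  ultimately show ?thesis
    using measure_pmf.prob_compl[of "{ps. \<forall>p\<in>set ps. P p}" "pmf_of_set ?L"] q by simp
qed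

text \<open>Bound 1 - q by exp (- q); the threshold 2 works because exp y \<ge> 1 + y > 3 for y >
  2.\<close>

lemma power_one_minus_less_third:
  fixes q :: real
  assumes "q \<le> 1" "2 < q * real s"
  shows "(1 - q) ^ s < 1 / 3"
proof -
  have "(1 - q) ^ s \<le> exp (- q) ^ s"
    using assms(1) exp_ge_add_one_self[of "- q"] by (intro power_mono) auto
  also have "\<dots> = inverse (exp (q * real s))"
    by (simp add: exp_of_nat_mult[symmetric] exp_minus[symmetric] mult.commute)
  also have "\<dots> < 1 / 3"
    using assms(2) exp_ge_add_one_self[of "q * real s"]
    by (simp add: inverse_eq_divide divide_less_eq del: exp_ge_add_one_self)
  finally show ?thesis .
qed

theorem theorem1p5:
  "\<exists>C::real. C > 0 \<and>
     (\<forall>(n::nat) (k::nat) (\<epsilon>::real) (\<alpha>::real) (\<beta>::ereal).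
        n \<ge> 1 \<longrightarrow> k \<ge> 2 \<longrightarrow> 0 < \<epsilon> \<longrightarrow> \<epsilon> < 1 \<longrightarrow> ereal \<alpha> < \<beta> \<longrightarrow>
        (\<exists>T :: point query_alg pmf.
           one_sided_tester n k \<alpha> \<beta> \<epsilon> T \<and> nonadaptive T \<and>
           makes_at_most T (C * inverse \<epsilon> * real n * log 2 (2 * real k))))"
proof (intro exI[of _ 18] conjI allI impI)
  fix n k :: nat and \<epsilon> \<alpha> :: real and \<beta> :: ereal
  assume n: "1 \<le> n" and k: "2 \<le> k" and \<epsilon>: "0 < \<epsilon>" "\<epsilon> < 1" and lt: "ereal \<alpha> < \<beta>"
  define S where "S = {1..n} \<times> grid n k"
  \<comment> \<open>If f is far, the failing fraction q exceeds \<epsilon> / (4 * n), so 8 * n /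
    \<epsilon> samples give q * s > 2.\<close>
  define s where "s = nat \<lceil>8 * real n / \<epsilon>\<rceil>"
  define L where "L = {ps. set ps \<subseteq> S \<and> length ps = s}"
  define T where "T = map_pmf (hub_alg k \<alpha> \<beta>) (pmf_of_set L)"
  have cardS: "card S = n * k ^ n" by (simp add: S_def card_grid card_cartesian_product)
  then have "0 < card S" using n k by simp
  then have S: "finite S" "S \<noteq> {}" by (auto simp: card_gt_0_iff)
  \<comment> \<open>This absorbs the rounding in s, turning 8 into 9.\<close>
  have "1 \<le> real n / \<epsilon>" using n \<epsilon> by (simp add: le_divide_eq)
  then have s: "8 * real n / \<epsilon> \<le> real s" "real s \<le> 9 * (real n / \<epsilon>)"
    unfolding s_def by linarith+
  obtain p where "p \<in> S" using S by blast
  then have "replicate s p \<in> L" by (auto simp: L_def set_replicate_conv_if)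
  then have L: "finite L" "L \<noteq> {}" using finite_lists_length_eq[OF S(1)] by (auto simp: L_def)
  have set_T: "set_pmf T = hub_alg k \<alpha> \<beta> ` L" by (simp add: T_def set_pmf_of_set L)
  have "one_sided_tester n k \<alpha> \<beta> \<epsilon> T"
    unfolding one_sided_tester_def
  proof (intro conjI ballI allI impI)
    fix A f assume "A \<in> set_pmf T"
    then show "set (queries A f) \<subseteq> grid n k"
      using set_sample_queries[of _ n k] by (fastforce simp: set_T queries_hub_alg L_def S_def)
  next
    fix f assume f: "ab_lipschitz n k \<alpha> \<beta> f"
    have "passes k \<alpha> \<beta> f p" if "ps \<in> L" "p \<in> set ps" for ps p
      using that by (intro ab_lipschitz_passes[OF f lt]) (auto simp: L_def S_def)
    then have "set_pmf T \<subseteq> {A. accepts A f}"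
      by (auto simp: set_T accepts_hub_alg)
    then show "measure_pmf.prob T {A. accepts A f} = 1"
      by (auto simp: measure_pmf.prob_eq_1 AE_measure_pmf_iff)
  next
    fix f assume f: "\<epsilon> < ab_dist n k \<alpha> \<beta> f"
    define q where "q = real (card {p \<in> S. \<not> passes k \<alpha> \<beta> f p}) / real (card S)"
    have "q \<le> 1"
      using card_mono[OF S(1), of "{p \<in> S. \<not> passes k \<alpha> \<beta> f p}"] \<open>0 < card S\<close>
      by (simp add: q_def divide_le_eq)
    have "\<epsilon> * real k ^ n < ab_dist n k \<alpha> \<beta> f * real k ^ n"
      using f k by (intro mult_strict_right_mono) auto
    also have "\<dots> \<le> 4 * (q * (real n * real k ^ n))"
      using ab_dist_le_hub_violations[of k \<alpha> \<beta> n f] k lt \<open>0 < card S\<close> cardS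
      by (simp add: q_def S_def)
    finally have "\<epsilon> * real k ^ n < (4 * q * real n) * real k ^ n" by (simp add: algebra_simps)
    then have "\<epsilon> < 4 * q * real n" using k by (simp add: mult_less_cancel_right)
    then have "\<epsilon> / (4 * real n) < q" using n by (simp add: divide_less_eq algebra_simps)
    then have "\<epsilon> / (4 * real n) * (8 * real n / \<epsilon>) < q * (8 * real n / \<epsilon>)"
      using n \<epsilon> by (intro mult_strict_right_mono) auto
    moreover have "q * (8 * real n / \<epsilon>) \<le> q * real s"
      using s(1) by (intro mult_left_mono) (auto simp: q_def)
    moreover have "\<epsilon> / (4 * real n) * (8 * real n / \<epsilon>) = 2" using n \<epsilon> by simp
    ultimately have "2 < q * real s" by linarith
    then have "(1 - q) ^ s < 1 / 3" by (rule power_one_minus_less_third[OF \<open>q \<le> 1\<close>])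
    moreover have "measure_pmf.prob T {A. \<not> accepts A f}
        = measure_pmf.prob (pmf_of_set L) {ps. \<exists>p\<in>set ps. \<not> passes k \<alpha> \<beta> f p}"
      by (simp add: T_def vimage_def accepts_hub_alg)
    ultimately show "2 / 3 < measure_pmf.prob T {A. \<not> accepts A f}"
      using prob_all_pass[OF S, of s "passes k \<alpha> \<beta> f"] by (simp add: L_def q_def)
  qed
  moreover have "nonadaptive T"
    by (auto simp: nonadaptive_def set_T queries_hub_alg)
  \<comment> \<open>18 = 9 * 2: at most 9 * n / \<epsilon> samples, each with at most 1 + log 2 (2 *
    k) \<le> 2 * log 2 (2 * k) queries.\<close>
  moreover have "makes_at_most T (18 * inverse \<epsilon> * real n * log 2 (2 * real k))"
    unfolding makes_at_most_def
  proof (intro ballI allI)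
    fix A f assume "A \<in> set_pmf T"
    then obtain ps where A: "A = hub_alg k \<alpha> \<beta> ps" "length ps = s" by (auto simp: set_T L_def)
    have log: "1 \<le> log 2 (2 * real k)" using k by (simp add: log_mult)
    have "real (length (queries A f)) \<le> real s * (1 + log 2 (2 * real k))"
      using length_concat_sample_queries[of k ps] k by (simp add: A queries_hub_alg)
    also have "\<dots> \<le> 9 * (real n / \<epsilon>) * (2 * log 2 (2 * real k))"
      using s(2) log \<epsilon> by (intro mult_mono) auto
    finally show "real (length (queries A f)) \<le> 18 * inverse \<epsilon> * real n * log 2 (2 * real k)"
      by (simp add: divide_inverse algebra_simps)
  qed
  ultimately show "\<exists>T :: point query_alg pmf. one_sided_tester n k \<alpha> \<beta> \<epsilon> T \<and> nonadaptive T \<and>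
      makes_at_most T (18 * inverse \<epsilon> * real n * log 2 (2 * real k))"
    by blast
qed simp

end
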